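(* Let $(\beta_i)_{i=0}^{\infty}$ be a sequence of positive real numbers such that (1) $\sum_{i=0}^{\infty}\beta_i<1$; (2) $\sqrt{n}\sum_{i=n}^{\infty}\beta_i\to 0$ as $n\to\infty$; (3) $\frac{1}{\sqrt{n}}\sum_{i=1}^{n} i\beta_i\to 0$ as $n\to\infty$; (4) $\sum_{i=1}^{\infty} i\beta_i<\infty$. Let $\{\Lambda_n\}_{n\ge 1}$ be the compensator of the discrete-time Hawkes process with parameters $(\beta_i)_{i\ge 0}$. Then $$\frac{\Lambda_n}{n}\to\frac{\beta_0}{1-\sum_{i=1}^{\infty}\beta_i}\quad\text{almost surely as } n\to\infty.$$
   Context: Discrete-time Hawkes process (DTHP): on a probability space $(\Omega,\mathcal{F},\mathbb{P})$, let $(\xi_n)_{n\ge 1}$ be $\{0,1\}$-valued random variables with $\mathbb{P}(\xi_1=1)=\beta_0$ and, for $n\ge 2$, $\mathbb{P}(\xi_n=1\mid \xi_1,\ldots,\xi_{n-1})=\beta_0+\sum_{i=1}^{n-1}\beta_{n-i}\xi_i$ (and $\xi_n=0$ with the complementary conditional probability). The DTHP is $H_n=\sum_{i=1}^n\xi_i$, $n\ge 1$. Let $\mathcal{F}_n=\sigma(\xi_1,\ldots,\xi_n)$, with $\mathcal{F}_0$ trivial. The compensator of the DTHP is $\Lambda_n=\sum_{i=1}^n\mathbb{E}(\xi_i\mid\mathcal{F}_{i-1})$, the increasing predictable part in the Doob decomposition of $H_n$. *)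

theory Defs
  imports "HOL-Probability.Probability"
begin

(* The sigma-algebra generated by xi_1, ..., xi_n; for n = 0 there are no generators, so it is
   the trivial one. Processes are indexed from 1: the value xi 0 is never used. *)
definition nat_filtration :: "'a measure \<Rightarrow> (nat \<Rightarrow> 'a \<Rightarrow> real) \<Rightarrow> nat \<Rightarrow> 'a measure" where
  "nat_filtration M \<xi> n =
     sigma (space M) {\<xi> i -` B \<inter> space M | i B. i \<in> {1..n} \<and> B \<in> sets borel}"

(* The conditional probability of {xi_n = 1} given xi_1, ..., xi_{n-1} is the conditional
   expectation of the indicator of this event. Since xi_n takes only the values 0 and 1, the
   conditional probability of {xi_n = 0} is then the complementary one. *)
locale discrete_hawkes = prob_space M for M :: "'a measure" +
  fixes \<beta> :: "nat \<Rightarrow> real" and \<xi> :: "nat \<Rightarrow> 'a \<Rightarrow> real"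
  assumes random_variable_xi: "\<And>n. n \<ge> 1 \<Longrightarrow> random_variable borel (\<xi> n)"
    and xi_values: "\<And>n \<omega>. n \<ge> 1 \<Longrightarrow> \<omega> \<in> space M \<Longrightarrow> \<xi> n \<omega> \<in> {0, 1}"
    and prob_xi_1: "prob {\<omega> \<in> space M. \<xi> 1 \<omega> = 1} = \<beta> 0"
    and cond_prob_xi: "\<And>n. n \<ge> 2 \<Longrightarrow>
          AE \<omega> in M. real_cond_exp M (nat_filtration M \<xi> (n - 1))
                       (indicator {\<omega> \<in> space M. \<xi> n \<omega> = 1}) \<omega>
                   = \<beta> 0 + (\<Sum>i=1..n - 1. \<beta> (n - i) * \<xi> i \<omega>)"

definition hawkes_count :: "(nat \<Rightarrow> 'a \<Rightarrow> real) \<Rightarrow> nat \<Rightarrow> 'a \<Rightarrow> real" where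
  "hawkes_count \<xi> n \<omega> = (\<Sum>i=1..n. \<xi> i \<omega>)"

(* The summands are the conditional expectations of the increments of hawkes_count, see
   hawkes_count_increment. *)
definition hawkes_compensator ::
    "'a measure \<Rightarrow> (nat \<Rightarrow> 'a \<Rightarrow> real) \<Rightarrow> nat \<Rightarrow> 'a \<Rightarrow> real" where
  "hawkes_compensator M \<xi> n \<omega> =
     (\<Sum>i=1..n. real_cond_exp M (nat_filtration M \<xi> (i - 1)) (\<xi> i) \<omega>)"

lemma hawkes_count_increment:
  "n \<ge> 1 \<Longrightarrow> hawkes_count \<xi> n \<omega> - hawkes_count \<xi> (n - 1) \<omega> = \<xi> n \<omega>"
  by (cases n) (simp_all add: hawkes_count_def)

lemma (in discrete_hawkes) subalgebra_nat_filtration: "subalgebra M (nat_filtration M \<xi> n)"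
proof -
  have "sets (nat_filtration M \<xi> n) =
      sigma_sets (space M) {\<xi> i -` B \<inter> space M | i B. i \<in> {1..n} \<and> B \<in> sets borel}"
    unfolding nat_filtration_def by (rule sets_measure_of) auto
  also have "\<dots> \<subseteq> sets M"
    by (rule sets.sigma_sets_subset) (auto intro!: measurable_sets[OF random_variable_xi])
  finally show ?thesis
    by (simp add: subalgebra_def nat_filtration_def space_measure_of_conv)
qed

end

theory Submission
  imports Defs "HOL-Library.Discrete_Functions"
begin

text \<open>
  The differences between \<open>\<xi>\<close> and its conditional expectations are bounded and pairwise
  orthogonal, so the second moments of their averages along the squares are summable; hence these
  averages tend to 0 almost surely, first along the squares and then, by boundedness, along all
  integers. So \<open>H n - \<Lambda> n = o(n)\<close>. Exchanging the order of summation in the definition of the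
  intensity gives \<open>\<Lambda> n = n \<beta>\<^sub>0 + B H n - E n\<close>, where \<open>B\<close> is the sum of the \<open>\<beta> i\<close> with \<open>i \<ge> 1\<close>
  and \<open>E n\<close> is at most a sum of the first \<open>n\<close> tails of this series, so \<open>E n = o(n)\<close>
  by Cesaro. Solving for \<open>\<Lambda> n / n\<close> gives the limit.
\<close>

section \<open>Deterministic limits of averages\<close>

lemma cesaro_null:
  fixes f :: "nat \<Rightarrow> real"
  assumes "f \<longlonglongrightarrow> 0"
  shows "(\<lambda>n. (\<Sum>i<n. f i) / real n) \<longlonglongrightarrow> 0"
proof (rule LIMSEQ_I)
  fix e :: real
  assume "e > 0"
  then obtain N where N: "\<And>n. n \<ge> N \<Longrightarrow> \<bar>f n\<bar> < e / 2"
    using LIMSEQ_D[OF assms, of "e / 2"] by auto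
  define K where "K = (\<Sum>i<N. \<bar>f i\<bar>)"
  have bound: "\<bar>\<Sum>i<n. f i\<bar> \<le> K + real n * (e / 2)" if "n \<ge> N" for n
  proof -
    have "\<bar>\<Sum>i<n. f i\<bar> \<le> (\<Sum>i<n. \<bar>f i\<bar>)" by (rule sum_abs)
    also have "\<dots> = K + (\<Sum>i=N..<n. \<bar>f i\<bar>)"
      unfolding K_def lessThan_atLeast0 using that by (simp add: sum.atLeastLessThan_concat)
    also have "(\<Sum>i=N..<n. \<bar>f i\<bar>) \<le> (\<Sum>i=N..<n. e / 2)"
      using N by (intro sum_mono) (simp add: less_imp_le)
    also have "\<dots> \<le> real n * (e / 2)" using \<open>e > 0\<close> by (auto intro!: mult_right_mono)
    finally show ?thesis by simp
  qed
  \<comment> \<open>Past \<open>N'\<close> the fixed head \<open>K\<close> is below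
    \<open>n * (e / 2)\<close>; the terms from \<open>N\<close> on account for the other half of
    \<open>e\<close>.\<close>
  obtain N' :: nat where N': "real N' > 2 * K / e" using reals_Archimedean2 by blast
  show "\<exists>no. \<forall>n\<ge>no. norm ((\<Sum>i<n. f i) / real n - 0) < e"
  proof (intro exI allI impI)
    fix n assume n: "n \<ge> max 1 (max N N')"
    then have "2 * K / e < real n" using N' by simp
    then have "K < real n * (e / 2)" using \<open>e > 0\<close> by (simp add: field_simps)
    then have "\<bar>\<Sum>i<n. f i\<bar> < real n * e" using bound[of n] n by simp
    then show "norm ((\<Sum>i<n. f i) / real n - 0) < e"
      using n by (simp add: divide_less_eq mult.commute)
  qed
qed

lemma filterlim_floor_sqrt: "filterlim floor_sqrt at_top at_top"
  unfolding filterlim_at_top eventually_sequentially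
  by (meson le_floor_sqrtI order_trans)

text \<open>If \<open>k\<close> is the integer square root of \<open>n\<close>, at most
  \<open>2 * k\<close> terms lie beyond \<open>k\<^sup>2\<close>. They change the sum by at most
  \<open>2 * k * c\<close>, which after division by \<open>k\<^sup>2\<close> leaves the vanishing
  error \<open>2 * c / k\<close> in \<open>g\<close>.\<close>

lemma averages_null_of_squares:
  fixes d :: "nat \<Rightarrow> real"
  assumes bound: "\<And>i. i \<ge> 1 \<Longrightarrow> \<bar>d i\<bar> \<le> c"
    and squares: "(\<lambda>k. (\<Sum>i=1..k\<^sup>2. d i) / real (k\<^sup>2)) \<longlonglongrightarrow> 0"
  shows "(\<lambda>n. (\<Sum>i=1..n. d i) / real n) \<longlonglongrightarrow> 0"
proof -
  define S where "S n = (\<Sum>i=1..n. d i)" for n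
  define g where "g k = \<bar>S (k\<^sup>2) / real (k\<^sup>2)\<bar> + 2 * c / real k" for k
  have "c \<ge> 0" using bound[of 1] by simp
  have "g \<longlonglongrightarrow> 0 + 0"
    unfolding g_def using squares[folded S_def]
    by (intro tendsto_add tendsto_rabs_zero lim_const_over_n)
  then have "g \<longlonglongrightarrow> 0" by simp
  then have lim: "(\<lambda>n. g (floor_sqrt n)) \<longlonglongrightarrow> 0"
    using filterlim_floor_sqrt by (rule filterlim_compose)
  have "norm (S n / real n) \<le> g (floor_sqrt n)" if "n \<ge> 1" for n
  proof -
    define k where "k = floor_sqrt n"
    have k: "k \<ge> 1" "k\<^sup>2 \<le> n" "n \<le> k\<^sup>2 + 2 * k"
      using that Suc_floor_sqrt_power2_gt[of n] floor_sqrt_power2_le[of n] unfolding k_def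
      by (auto simp: power2_eq_square Suc_le_eq simp del: floor_sqrt_power2_le)
    have split: "{1..n} = {1..k\<^sup>2} \<union> {k\<^sup>2<..n}" using k by auto
    have "S n = S (k\<^sup>2) + (\<Sum>i\<in>{k\<^sup>2<..n}. d i)"
      unfolding S_def split by (rule sum.union_disjoint) auto
    moreover have "\<bar>\<Sum>i\<in>{k\<^sup>2<..n}. d i\<bar> \<le> (\<Sum>i\<in>{k\<^sup>2<..n}. c)"
      by (rule order_trans[OF sum_abs sum_mono]) (simp add: bound)
    moreover have "(\<Sum>i\<in>{k\<^sup>2<..n}. c) \<le> real (2 * k) * c"
      using k \<open>c \<ge> 0\<close> unfolding sum_constant card_greaterThanAtMost
      by (intro mult_right_mono of_nat_mono) auto
    ultimately have "\<bar>S n\<bar> \<le> \<bar>S (k\<^sup>2)\<bar> + 2 * k * c" by simp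
    \<comment> \<open>The denominator \<open>n\<close> is lowered to \<open>k\<^sup>2\<close>, which
      is positive because \<open>n \<ge> 1\<close> forces \<open>k \<ge> 1\<close>.\<close>
    then have "\<bar>S n\<bar> / real n \<le> (\<bar>S (k\<^sup>2)\<bar> + 2 * k * c) / real (k\<^sup>2)"
      using k \<open>c \<ge> 0\<close> by (intro frac_le) (auto simp del: of_nat_power)
    also have "\<dots> = g k" using k by (simp add: g_def field_simps power2_eq_square)
    finally show ?thesis by (simp add: k_def)
  qed
  then have "eventually (\<lambda>n. norm (S n / real n) \<le> g (floor_sqrt n)) sequentially"
    by (auto simp: eventually_sequentially)
  then have "(\<lambda>n. S n / real n) \<longlonglongrightarrow> 0" using lim by (rule Lim_null_comparison)
  then show ?thesis by (simp add: S_def)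
qed

section \<open>A strong law for bounded orthogonal variables\<close>

text \<open>Sum and integral may be exchanged for nonnegative terms, so the series has finite
  integral. It is then finite almost everywhere, and the terms of a convergent series tend to
  0.\<close>

lemma AE_tendsto_zero_of_summable_integral:
  fixes f :: "nat \<Rightarrow> 'a \<Rightarrow> real"
  assumes int: "\<And>k. integrable M (f k)"
    and nonneg: "\<And>k x. 0 \<le> f k x"
    and summable: "summable (\<lambda>k. \<integral>x. f k x \<partial>M)"
  shows "AE x in M. (\<lambda>k. f k x) \<longlonglongrightarrow> 0"
proof -
  have [measurable]: "f k \<in> borel_measurable M" for k using int by auto
  have "(\<integral>\<^sup>+x. (\<Sum>k. ennreal (f k x)) \<partial>M) = (\<Sum>k. \<integral>\<^sup>+x. ennreal (f k x) \<partial>M)"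
    by (rule nn_integral_suminf) measurable
  also have "\<dots> = (\<Sum>k. ennreal (\<integral>x. f k x \<partial>M))"
    by (simp add: nn_integral_eq_integral int nonneg)
  also have "\<dots> = ennreal (\<Sum>k. \<integral>x. f k x \<partial>M)"
    using summable by (intro suminf_ennreal2) (simp_all add: nonneg)
  finally have "(\<integral>\<^sup>+x. (\<Sum>k. ennreal (f k x)) \<partial>M) \<noteq> \<infinity>" by simp
  then have "AE x in M. (\<Sum>k. ennreal (f k x)) \<noteq> \<infinity>"
    by (intro nn_integral_PInf_AE) measurable
  then show ?thesis
    by eventually_elim (auto intro!: summable_LIMSEQ_zero summable_suminf_not_top simp: nonneg)
qed

text \<open>Orthogonality removes the cross terms, so the second moment of the \<open>n\<close>-th
  partial sum is at most \<open>n * c\<^sup>2\<close>, and that of the average at most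
  \<open>c\<^sup>2 / n\<close>. This bound is summable along the squares, though not along all
  \<open>n\<close>; boundedness fills the gaps.\<close>

lemma (in prob_space) strong_law_orthogonal_bounded:
  fixes D :: "nat \<Rightarrow> 'a \<Rightarrow> real"
  assumes rv: "\<And>i. i \<ge> 1 \<Longrightarrow> random_variable borel (D i)"
    and bound: "\<And>i \<omega>. i \<ge> 1 \<Longrightarrow> \<omega> \<in> space M \<Longrightarrow> \<bar>D i \<omega>\<bar> \<le> c"
    and orth: "\<And>i j. 1 \<le> i \<Longrightarrow> i < j \<Longrightarrow> expectation (\<lambda>\<omega>. D i \<omega> * D j \<omega>) = 0"
  shows "AE \<omega> in M. (\<lambda>n. (\<Sum>i=1..n. D i \<omega>) / real n) \<longlonglongrightarrow> 0"
proof -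
  define S where "S n \<omega> = (\<Sum>i=1..n. D i \<omega>)" for n \<omega>
  have int: "integrable M (\<lambda>\<omega>. D i \<omega> * D j \<omega>)" if "i \<ge> 1" "j \<ge> 1" for i j
    using that rv bound
    by (intro integrable_const_bound[where B = "c * c"] AE_I2)
       (auto simp: abs_mult intro!: mult_mono order_trans[OF abs_ge_zero bound])
  have S2: "(S n \<omega>)\<^sup>2 = (\<Sum>i=1..n. \<Sum>j=1..n. D i \<omega> * D j \<omega>)" for n \<omega>
    by (simp add: S_def power2_eq_square sum_product)
  have intS: "integrable M (\<lambda>\<omega>. (S n \<omega>)\<^sup>2)" for n
    unfolding S2 by (intro Bochner_Integration.integrable_sum int) auto
  have ES: "expectation (\<lambda>\<omega>. (S n \<omega>)\<^sup>2) \<le> real n * c\<^sup>2" for n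
  proof -
    have "expectation (\<lambda>\<omega>. (S n \<omega>)\<^sup>2) = (\<Sum>i=1..n. \<Sum>j=1..n. expectation (\<lambda>\<omega>. D i \<omega> * D j \<omega>))"
      unfolding S2 using int
      by (subst Bochner_Integration.integral_sum)
         (auto intro!: Bochner_Integration.integral_sum Bochner_Integration.integrable_sum sum.cong)
    \<comment> \<open>In this form the inner sum collapses to its diagonal term.\<close>
    also have "\<dots> = (\<Sum>i=1..n. \<Sum>j=1..n. if j = i then expectation (\<lambda>\<omega>. D i \<omega> * D i \<omega>) else 0)"
    proof (intro sum.cong refl)
      fix i j assume "i \<in> {1..n}" "j \<in> {1..n}"
      then show "expectation (\<lambda>\<omega>. D i \<omega> * D j \<omega>)
          = (if j = i then expectation (\<lambda>\<omega>. D i \<omega> * D i \<omega>) else 0)"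
        using orth[of i j] orth[of j i] by (cases i j rule: linorder_cases) (auto simp: mult.commute)
    qed
    also have "\<dots> = (\<Sum>i=1..n. expectation (\<lambda>\<omega>. D i \<omega> * D i \<omega>))" by simp
    also have "\<dots> \<le> (\<Sum>i=1..n. c\<^sup>2)"
    proof (intro sum_mono)
      fix i assume i: "i \<in> {1..n}"
      have "D i \<omega> * D i \<omega> \<le> c\<^sup>2" if "\<omega> \<in> space M" for \<omega>
        using bound[of i \<omega>] that i abs_le_square_iff[of "D i \<omega>" c]
        by (simp add: power2_eq_square)
      then have "expectation (\<lambda>\<omega>. D i \<omega> * D i \<omega>) \<le> expectation (\<lambda>_. c\<^sup>2)"
        using i by (intro integral_mono int) auto
      then show "expectation (\<lambda>\<omega>. D i \<omega> * D i \<omega>) \<le> c\<^sup>2" by (simp add: prob_space)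
    qed
    finally show ?thesis by simp
  qed
  have "AE \<omega> in M. (\<lambda>k. (S (k\<^sup>2) \<omega> / real (k\<^sup>2))\<^sup>2) \<longlonglongrightarrow> 0"
  proof (rule AE_tendsto_zero_of_summable_integral)
    show "integrable M (\<lambda>\<omega>. (S (k\<^sup>2) \<omega> / real (k\<^sup>2))\<^sup>2)" for k
      using intS by (simp add: power_divide)
    have b: "norm (expectation (\<lambda>\<omega>. (S (k\<^sup>2) \<omega> / real (k\<^sup>2))\<^sup>2)) \<le> c\<^sup>2 * inverse (real k ^ 2)" for k
    \<comment> \<open>At \<open>k = 0\<close> division by zero gives 0 on both sides, so the bound
      holds for every \<open>k\<close>.\<close>
    proof (cases "k = 0")
      case False
      have "expectation (\<lambda>\<omega>. (S (k\<^sup>2) \<omega> / real (k\<^sup>2))\<^sup>2)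
          = expectation (\<lambda>\<omega>. (S (k\<^sup>2) \<omega>)\<^sup>2) / (real (k\<^sup>2))\<^sup>2"
        by (simp add: power_divide)
      also have "\<dots> \<le> real (k\<^sup>2) * c\<^sup>2 / (real (k\<^sup>2))\<^sup>2"
        by (intro divide_right_mono ES) simp
      also have "\<dots> = c\<^sup>2 * inverse (real k ^ 2)"
        using False by (simp add: field_simps power2_eq_square)
      finally show ?thesis by simp
    qed simp
    have s: "summable (\<lambda>k. c\<^sup>2 * inverse (real k ^ 2))"
      by (intro summable_mult inverse_power_summable) simp
    show "summable (\<lambda>k. expectation (\<lambda>\<omega>. (S (k\<^sup>2) \<omega> / real (k\<^sup>2))\<^sup>2))"
      by (rule summable_comparison_test'[OF s b])
  qed simp
  with AE_space show ?thesis
  proof eventually_elim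
    case (elim \<omega>)
    then have "(\<lambda>k. S (k\<^sup>2) \<omega> / real (k\<^sup>2)) \<longlonglongrightarrow> 0"
      by (simp add: power_tendsto_0_iff del: of_nat_power)
    then show ?case
      unfolding S_def using elim bound by (intro averages_null_of_squares) auto
  qed
qed

section \<open>Pathwise analysis of the summed intensity\<close>

text \<open>An event at time \<open>j\<close> adds \<open>b 1\<close>, ..., \<open>b (n - j)\<close>
  to the intensities up to time \<open>n\<close>. Passing to \<open>Suc n\<close> lengthens each
  inner sum by one term, and these terms make up the new outer summand.\<close>

lemma sum_convolution_swap:
  fixes b x :: "nat \<Rightarrow> real"
  shows "(\<Sum>i=1..n. \<Sum>j=1..i - 1. b (i - j) * x j)
    = (\<Sum>j=1..n. x j * (\<Sum>k<n - j. b (Suc k)))"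
proof (induction n)
  case (Suc n)
  have "(\<Sum>j=1..n. x j * (\<Sum>k<Suc n - j. b (Suc k)))
      = (\<Sum>j=1..n. x j * (\<Sum>k<n - j. b (Suc k)) + b (Suc n - j) * x j)"
    by (intro sum.cong refl) (auto simp: Suc_diff_le algebra_simps)
  then show ?case using Suc by (simp add: sum.distrib)
qed simp

text \<open>For a single path, \<open>L_eq\<close> is a linear equation for \<open>L n\<close> with
  coefficient \<open>B < 1\<close>. Its perturbations \<open>T n\<close> and \<open>E n\<close> are
  both o(n), so dividing by \<open>n\<close> and by \<open>1 - B\<close> gives the limit.\<close>

lemma hawkes_intensity_average:
  fixes b x :: "nat \<Rightarrow> real"
  assumes b: "\<And>i. b (Suc i) \<ge> 0" "summable b" and b1: "(\<Sum>i. b (Suc i)) < 1"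
    and x: "\<And>i. i \<ge> 1 \<Longrightarrow> x i \<in> {0..1}"
    and L: "\<And>n. L n = (\<Sum>i=1..n. b 0 + (\<Sum>j=1..i - 1. b (i - j) * x j))"
    and null: "(\<lambda>n. ((\<Sum>i=1..n. x i) - L n) / real n) \<longlonglongrightarrow> 0"
  shows "(\<lambda>n. L n / real n) \<longlonglongrightarrow> b 0 / (1 - (\<Sum>i. b (Suc i)))"
proof -
  define B where "B = (\<Sum>i. b (Suc i))"
  \<comment> \<open>\<open>R m\<close> is the tail of the series, the sum of \<open>b i\<close> over
    \<open>i > m\<close>.\<close>
  define R where "R m = B - (\<Sum>k<m. b (Suc k))" for m
  \<comment> \<open>the intensity that the events up to time \<open>n\<close> generate only after time \<open>n\<close>\<close>
  define E where "E n = (\<Sum>j=1..n. x j * R (n - j))" for n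
  have sb: "summable (\<lambda>i. b (Suc i))" using b by (simp add: summable_Suc_iff)
  have R0: "R m \<ge> 0" for m
    unfolding R_def B_def using sum_le_suminf[OF sb, of "{..<m}"] b by simp
  have "R \<longlonglongrightarrow> B - B"
    unfolding R_def B_def by (intro tendsto_diff tendsto_const summable_LIMSEQ sb)
  then have cesaro: "(\<lambda>n. (\<Sum>m<n. R m) / real n) \<longlonglongrightarrow> 0" by (intro cesaro_null) simp
  have E: "0 \<le> E n" "E n \<le> (\<Sum>m<n. R m)" for n
  proof -
    show "0 \<le> E n" unfolding E_def using x R0 by (intro sum_nonneg mult_nonneg_nonneg) auto
    have "E n \<le> (\<Sum>j=1..n. R (n - j))"
      unfolding E_def using x R0 by (intro sum_mono mult_left_le_one_le) auto
    also have "\<dots> = (\<Sum>m<n. R m)"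
      by (rule sum.reindex_bij_witness[of _ "\<lambda>m. n - m" "\<lambda>j. n - j"]) auto
    finally show "E n \<le> (\<Sum>m<n. R m)" .
  qed
  have E_lim: "(\<lambda>n. E n / real n) \<longlonglongrightarrow> 0"
    by (rule tendsto_sandwich[OF _ _ tendsto_const cesaro])
       (auto intro!: always_eventually divide_right_mono divide_nonneg_nonneg E)
  define T where "T n = (\<Sum>i=1..n. x i) - L n" for n
  have L_eq: "L n = real n * b 0 + B * (T n + L n) - E n" for n
  proof -
    \<comment> \<open>Each truncated inner sum is the full sum \<open>B\<close> minus a tail. The
      full parts add up to \<open>B\<close> times the number of events, which is
      \<open>T n + L n\<close>; the tails add up to \<open>E n\<close>.\<close>
    have "(\<Sum>j=1..n. x j * (\<Sum>k<n - j. b (Suc k))) = (\<Sum>j=1..n. B * x j - x j * R (n - j))"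
      unfolding R_def by (intro sum.cong refl) (simp add: algebra_simps)
    then show ?thesis
      by (simp add: L[of n] sum.distrib sum_convolution_swap T_def E_def sum_subtractf
          sum_distrib_left[of B] del: One_nat_def)
  qed
  have "B < 1" using b1 by (simp add: B_def)
  have "L n / real n = (b 0 + B * (T n / real n) - E n / real n) / (1 - B)" if "n \<ge> 1" for n
    using that L_eq[of n] \<open>B < 1\<close> by (simp add: divide_simps) (simp add: algebra_simps)
  \<comment> \<open>At \<open>n = 0\<close> the left side is \<open>b 0 / (1 - B)\<close> while
    \<open>L n / real n\<close> is 0, so the equality is only eventual.\<close>
  then have "eventually (\<lambda>n. (b 0 + B * (T n / real n) - E n / real n) / (1 - B) = L n / real n) sequentially"
    unfolding eventually_sequentially by (metis (no_types))
  moreover have "(\<lambda>n. (b 0 + B * (T n / real n) - E n / real n) / (1 - B))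
      \<longlonglongrightarrow> (b 0 + B * 0 - 0) / (1 - B)"
    using \<open>B < 1\<close> null by (intro tendsto_intros E_lim) (simp_all add: T_def)
  ultimately show ?thesis
    unfolding B_def[symmetric] by (simp add: Lim_transform_eventually)
qed

section \<open>Conditional expectations and the martingale differences\<close>

context discrete_hawkes
begin

text \<open>For \<open>n = 1\<close> the sum is empty and the value is \<open>\<beta> 0\<close>, so
  one formula covers both the initial law and the conditional law of the process.\<close>

definition intensity :: "nat \<Rightarrow> 'a \<Rightarrow> real" where
  "intensity n \<omega> = \<beta> 0 + (\<Sum>j=1..n - 1. \<beta> (n - j) * \<xi> j \<omega>)"

lemma xi_measurable_filtration:
  assumes "1 \<le> i" "i \<le> n"
  shows "\<xi> i \<in> borel_measurable (nat_filtration M \<xi> n)"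
proof (rule measurableI)
  fix B :: "real set" assume "B \<in> sets borel"
  moreover have "space (nat_filtration M \<xi> n) = space M"
    using subalgebra_nat_filtration by (simp add: subalgebra_def)
  moreover have "sets (nat_filtration M \<xi> n) =
      sigma_sets (space M) {\<xi> i -` B \<inter> space M | i B. i \<in> {1..n} \<and> B \<in> sets borel}"
    unfolding nat_filtration_def by (rule sets_measure_of) auto
  ultimately show "\<xi> i -` B \<inter> space (nat_filtration M \<xi> n) \<in> sets (nat_filtration M \<xi> n)"
    using assms by (auto intro!: sigma_sets.Basic)
qed simp

text \<open>Predictability: only \<open>\<xi> j\<close> with \<open>j \<le> n - 1 \<le> m\<close>
  enter.\<close>

lemma intensity_measurable_filtration:
  "n \<le> Suc m \<Longrightarrow> intensity n \<in> borel_measurable (nat_filtration M \<xi> m)"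
  unfolding intensity_def
  by (intro borel_measurable_add borel_measurable_sum borel_measurable_times
      xi_measurable_filtration) auto

lemma finite_measure_subalgebra_filtration:
  "finite_measure_subalgebra M (nat_filtration M \<xi> n)"
  by unfold_locales (rule subalgebra_nat_filtration)

lemma integrable_xi: "n \<ge> 1 \<Longrightarrow> integrable M (\<xi> n)"
  using xi_values[of n] random_variable_xi[of n]
  by (intro integrable_const_bound[where B = 1] AE_I2) force+

lemma xi_eq_indicator:
  "n \<ge> 1 \<Longrightarrow> \<omega> \<in> space M \<Longrightarrow> \<xi> n \<omega> = indicator {\<omega> \<in> space M. \<xi> n \<omega> = 1} \<omega>"
  using xi_values[of n \<omega>] by (auto simp: indicator_def)

lemma cond_exp_xi:
  assumes n: "n \<ge> 1"
  shows "AE \<omega> in M. real_cond_exp M (nat_filtration M \<xi> (n - 1)) (\<xi> n) \<omega> = intensity n \<omega>"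
proof -
  interpret F: finite_measure_subalgebra M "nat_filtration M \<xi> (n - 1)"
    by (rule finite_measure_subalgebra_filtration)
  note [measurable] = random_variable_xi[OF n]
  show ?thesis
  proof (cases "n = 1")
    case True
    have E: "expectation (\<xi> 1) = \<beta> 0"
    proof -
      have "expectation (\<xi> 1) = expectation (indicator {\<omega> \<in> space M. \<xi> 1 \<omega> = 1})"
        by (intro Bochner_Integration.integral_cong refl xi_eq_indicator) auto
      also have "\<dots> = prob {\<omega> \<in> space M. \<xi> 1 \<omega> = 1}"
        using True by (subst Bochner_Integration.integral_indicator) (auto intro!: arg_cong[where f = prob])
      finally show ?thesis using prob_xi_1 by simp
    qed
    have "AE \<omega> in M. real_cond_exp M (nat_filtration M \<xi> (n - 1)) (\<xi> n) \<omega> = \<beta> 0"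
    proof (rule F.real_cond_exp_charact)
      \<comment> \<open>With no generators the sigma-algebra is trivial, so the defining integrals
        need checking on two sets only.\<close>
      fix A assume "A \<in> sets (nat_filtration M \<xi> (n - 1))"
      then have "A = {} \<or> A = space M"
        using True by (auto simp: nat_filtration_def sigma_sets_empty_eq)
      then show "(\<integral>x\<in>A. \<xi> n x \<partial>M) = (\<integral>x\<in>A. \<beta> 0 \<partial>M)"
        using E True integrable_xi[of 1]
        by (auto simp: set_lebesgue_integral_def[of _ "{}"] set_integral_space prob_space)
    qed (use integrable_xi[OF n] in auto)
    then show ?thesis using True by (simp add: intensity_def)
  next
    case False
    have "AE \<omega> in M. real_cond_exp M (nat_filtration M \<xi> (n - 1)) (\<xi> n) \<omega>
        = real_cond_exp M (nat_filtration M \<xi> (n - 1)) (indicator {\<omega> \<in> space M. \<xi> n \<omega> = 1}) \<omega>"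
      by (intro F.real_cond_exp_cong AE_I2 xi_eq_indicator[OF n]) simp_all
    moreover have "AE \<omega> in M. real_cond_exp M (nat_filtration M \<xi> (n - 1))
        (indicator {\<omega> \<in> space M. \<xi> n \<omega> = 1}) \<omega> = intensity n \<omega>"
      unfolding intensity_def using False n by (intro cond_prob_xi) simp
    ultimately show ?thesis by eventually_elim simp
  qed
qed

text \<open>Each conditional expectation is known up to a null set; countably many of these combine
  into one that serves all \<open>n\<close>.\<close>

lemma AE_compensator:
  "AE \<omega> in M. \<forall>n. hawkes_compensator M \<xi> n \<omega> = (\<Sum>i=1..n. intensity i \<omega>)"
proof -
  have "AE \<omega> in M. \<forall>i. i \<ge> 1 \<longrightarrow>
      real_cond_exp M (nat_filtration M \<xi> (i - 1)) (\<xi> i) \<omega> = intensity i \<omega>"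
    unfolding AE_all_countable using cond_exp_xi by auto
  then show ?thesis
    by eventually_elim (auto simp: hawkes_compensator_def intro!: sum.cong)
qed

lemma intensity_bounds:
  assumes "\<And>i. \<beta> i \<ge> 0" "summable \<beta>" "(\<Sum>i. \<beta> i) \<le> 1" "n \<ge> 1" "\<omega> \<in> space M"
  shows "intensity n \<omega> \<in> {0..1}"
proof -
  have xi: "\<xi> j \<omega> \<in> {0..1}" if "j \<ge> 1" for j using xi_values[OF that assms(5)] by auto
  have "intensity n \<omega> \<le> \<beta> 0 + (\<Sum>j=1..n - 1. \<beta> (n - j))"
    unfolding intensity_def using xi assms(1)
    by (intro add_left_mono sum_mono mult_right_le_one_le) auto
  \<comment> \<open>Reversing the index turns the bound into a partial sum of the series, with
    \<open>\<beta> 0\<close> as its missing first term.\<close>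
  also have "(\<Sum>j=1..n - 1. \<beta> (n - j)) = (\<Sum>k=1..<n. \<beta> k)"
    by (rule sum.reindex_bij_witness[of _ "\<lambda>k. n - k" "\<lambda>j. n - j"]) auto
  also have "\<beta> 0 + (\<Sum>k=1..<n. \<beta> k) = (\<Sum>k<n. \<beta> k)"
    using assms(4) by (simp add: lessThan_atLeast0 sum.atLeast_Suc_lessThan)
  also have "\<dots> \<le> (\<Sum>k. \<beta> k)" using assms(1,2) by (intro sum_le_suminf) auto
  finally have "intensity n \<omega> \<le> 1" using assms(3) by simp
  moreover have "0 \<le> intensity n \<omega>"
    unfolding intensity_def using xi assms(1)
    by (intro add_nonneg_nonneg sum_nonneg mult_nonneg_nonneg) auto
  ultimately show ?thesis by simp
qed

text \<open>For \<open>i < j\<close> the \<open>i\<close>-th difference is known at time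
  \<open>j - 1\<close>. Conditioning on that time replaces \<open>\<xi> j\<close> by
  \<open>intensity j\<close> inside the expectation, so the differences are orthogonal; both terms
  lie in [0, 1], so they are bounded by 1.\<close>

lemma AE_martingale_average_null:
  assumes "\<And>i. \<beta> i \<ge> 0" "summable \<beta>" "(\<Sum>i. \<beta> i) \<le> 1"
  shows "AE \<omega> in M. (\<lambda>n. (\<Sum>i=1..n. \<xi> i \<omega> - intensity i \<omega>) / real n) \<longlonglongrightarrow> 0"
proof (rule strong_law_orthogonal_bounded[where c = 1])
  have rv: "random_variable borel (intensity n)" for n
    by (rule measurable_from_subalg[OF subalgebra_nat_filtration
          intensity_measurable_filtration[of n n]]) simp
  show rvD: "random_variable borel (\<lambda>\<omega>. \<xi> i \<omega> - intensity i \<omega>)" if "i \<ge> 1" for i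
    by (intro borel_measurable_diff random_variable_xi rv that)
  show bound: "\<bar>\<xi> i \<omega> - intensity i \<omega>\<bar> \<le> 1" if "i \<ge> 1" "\<omega> \<in> space M" for i \<omega>
    using intensity_bounds[OF assms that] xi_values[OF that] by auto
  fix i j :: nat assume ij: "1 \<le> i" "i < j"
  interpret F: finite_measure_subalgebra M "nat_filtration M \<xi> (j - 1)"
    by (rule finite_measure_subalgebra_filtration)
  let ?D = "\<lambda>\<omega>. \<xi> i \<omega> - intensity i \<omega>"
  have D: "?D \<in> borel_measurable (nat_filtration M \<xi> (j - 1))"
    using ij by (intro borel_measurable_diff xi_measurable_filtration
        intensity_measurable_filtration) auto
  have [measurable]: "random_variable borel (\<xi> j)" "random_variable borel ?D"
    "random_variable borel (intensity j)"
    using ij random_variable_xi rvD rv by auto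
  have int: "integrable M (\<lambda>\<omega>. ?D \<omega> * \<xi> j \<omega>)"
  proof (rule integrable_const_bound[where B = 1])
    have "norm (?D \<omega> * \<xi> j \<omega>) \<le> 1 * 1" if "\<omega> \<in> space M" for \<omega>
      unfolding norm_mult using bound[of i \<omega>] xi_values[of j \<omega>] ij that
      by (intro mult_mono) auto
    then show "AE \<omega> in M. norm (?D \<omega> * \<xi> j \<omega>) \<le> 1" by simp
  qed measurable
  have int': "integrable M (\<lambda>\<omega>. ?D \<omega> * intensity j \<omega>)"
  proof (rule integrable_const_bound[where B = 1])
    have "norm (?D \<omega> * intensity j \<omega>) \<le> 1 * 1" if "\<omega> \<in> space M" for \<omega>
      unfolding norm_mult using bound[of i \<omega>] intensity_bounds[OF assms, of j \<omega>] ij that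
      by (intro mult_mono) auto
    then show "AE \<omega> in M. norm (?D \<omega> * intensity j \<omega>) \<le> 1" by simp
  qed measurable
  have "expectation (\<lambda>\<omega>. ?D \<omega> * \<xi> j \<omega>)
      = expectation (\<lambda>\<omega>. ?D \<omega> * real_cond_exp M (nat_filtration M \<xi> (j - 1)) (\<xi> j) \<omega>)"
    by (rule F.real_cond_exp_intg(2)[symmetric, OF int D]) measurable
  also have "\<dots> = expectation (\<lambda>\<omega>. ?D \<omega> * intensity j \<omega>)"
    using cond_exp_xi[of j] ij
    by (intro integral_cong_AE) (auto intro: borel_measurable_times)
  finally show "expectation (\<lambda>\<omega>. ?D \<omega> * (\<xi> j \<omega> - intensity j \<omega>)) = 0"
    using int int' by (simp add: right_diff_distrib)
qed

end

section \<open>Almost sure convergence of the compensator average\<close>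

theorem theorem5p1:
  fixes M :: "'a measure" and \<beta> :: "nat \<Rightarrow> real" and \<xi> :: "nat \<Rightarrow> 'a \<Rightarrow> real"
  assumes beta_pos: "\<And>i. \<beta> i > 0"
    and beta_summable: "summable \<beta>" and beta_sum: "(\<Sum>i. \<beta> i) < 1"
    and tail: "(\<lambda>n. sqrt (real n) * (\<Sum>i. \<beta> (n + i))) \<longlonglongrightarrow> 0"
    and partial: "(\<lambda>n. 1 / sqrt (real n) * (\<Sum>i=1..n. real i * \<beta> i)) \<longlonglongrightarrow> 0"
    and first_moment: "summable (\<lambda>i. real (Suc i) * \<beta> (Suc i))"
    and hawkes: "discrete_hawkes M \<beta> \<xi>"
  shows "AE \<omega> in M. (\<lambda>n. hawkes_compensator M \<xi> n \<omega> / real n)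
           \<longlonglongrightarrow> \<beta> 0 / (1 - (\<Sum>i. \<beta> (Suc i)))"
proof -
  interpret discrete_hawkes M \<beta> \<xi> by (rule hawkes)
  have nonneg: "\<beta> i \<ge> 0" for i using beta_pos[of i] by simp
  have B: "(\<Sum>i. \<beta> (Suc i)) < 1"
    using suminf_split_head[OF beta_summable] beta_sum nonneg[of 0] by simp
  \<comment> \<open>Off a single null set the averaged differences vanish and the compensator is the
    summed intensity; what remains is the pathwise argument for each such
    \<open>\<omega>\<close>.\<close>
  from AE_martingale_average_null[OF nonneg beta_summable less_imp_le[OF beta_sum]]
    AE_compensator AE_space
  show ?thesis
  proof eventually_elim
    case (elim \<omega>)
    then have "\<xi> i \<omega> \<in> {0..1}" if "i \<ge> 1" for i using xi_values[OF that, of \<omega>] by auto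
    moreover have "hawkes_compensator M \<xi> n \<omega>
        = (\<Sum>i=1..n. \<beta> 0 + (\<Sum>j=1..i - 1. \<beta> (i - j) * \<xi> j \<omega>))" for n
      using elim by (simp add: intensity_def)
    ultimately show ?case
      using elim nonneg beta_summable B
      by (intro hawkes_intensity_average[where x = "\<lambda>i. \<xi> i \<omega>"]) (auto simp: sum_subtractf)
  qed
qed

end
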